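(* Let $n$ be an integer and let $C_n=\sup\{|S\cap[1,n^2]| : S \text{ has the property } D(n)\}$. If $|n|>400$, then $C_n<11.006\,\log|n|$. If $|n|\geq 10^{100}$, then $C_n<8.37\,\log|n|$.
   Context: For a nonzero integer $n$, a set of $m$ (distinct) positive integers $S=\{a_1,a_2,\ldots,a_m\}$ is said to have the property $D(n)$ if $a_ia_j+n$ is a perfect square (the square of an integer, $0$ allowed) for all $1\leq i<j\leq m$. The supremum defining $C_n$ is over all sets $S$ of positive integers with the property $D(n)$, of any size $m$. Here $\log$ denotes the natural logarithm, and $[1,n^2]$ is the closed interval. *)

theory Defs
  imports Complex_Main "HOL-Computational_Algebra.Nth_Powers"
begin

definition has_property_D :: "int \<Rightarrow> int set \<Rightarrow> bool" where
  "has_property_D n S \<longleftrightarrow>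
     finite S \<and> S \<subseteq> {0<..} \<and>
     (\<forall>a\<in>S. \<forall>b\<in>S. a \<noteq> b \<longrightarrow> is_square (a * b + n))"

definition C :: "int \<Rightarrow> nat" where
  "C n = (SUP S \<in> {S. has_property_D n S}. card (S \<inter> {1..n\<^sup>2}))"

text \<open>
  The supremum in \<^const>\<open>C\<close> is taken in \<^typ>\<open>nat\<close>, so it is meaningful only
  for a nonempty family of cardinalities that is bounded above; the next two lemmas
  show that this is the case.
\<close>

lemma has_property_D_empty: "has_property_D n {}"
  by (simp add: has_property_D_def)

lemma bdd_above_card_property_D:
  "bdd_above ((\<lambda>S. card (S \<inter> {1..n\<^sup>2})) ` {S. has_property_D n S})"
proof (rule bdd_aboveI2)
  show "card (S \<inter> {1..n\<^sup>2}) \<le> card {1..n\<^sup>2}" for S :: "int set"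
    by (rule card_mono) simp_all
qed

end

theory Submission
  imports Defs "HOL-Number_Theory.Number_Theory" "HOL-Analysis.Harmonic_Numbers" "HOL-Analysis.Complex_Transcendental"
begin

text \<open>
  Let \<open>A\<close> be the part of \<open>S\<close> in \<open>[1, n\<^sup>2]\<close>, \<open>Z = |A|\<close> and \<open>L = log |n|\<close>. If \<open>p\<close> is an odd prime not dividing
  \<open>n\<close>, then \<open>a b + n\<close> is a quadratic residue or zero modulo \<open>p\<close> for all distinct \<open>a\<close>, \<open>b\<close> in \<open>A\<close>, and a bilinear
  character sum estimate shows that \<open>A\<close> occupies at most \<open>\<surd>p + 3\<close> residue classes modulo \<open>p\<close>. Gallagher's
  larger sieve then gives \<open>\<Sum> log p (1 / (\<surd>p + 3) - 1 / Z) \<le> 2 L\<close> over any set of such primes.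
  If \<open>Z \<ge> K\<close>, take all primes \<open>5 \<le> p \<le> (K - 3)\<^sup>2\<close>, for which the weights with \<open>1 / K\<close> in place of \<open>1 / Z\<close> are
  nonnegative; the omitted prime divisors of \<open>n\<close> account for at most \<open>L / 5\<close>. By partial summation the
  Chebyshev bound \<open>\<theta>(t) - log 6 \<ge> (t - 4) / 3\<close> makes the sum over all these primes at least
  \<open>(K - 6 log K) / 3\<close>, which exceeds \<open>2.2 L\<close> for both values of \<open>K\<close>.
\<close>

section \<open>The larger sieve\<close>

text \<open>Distinct primes are pairwise coprime, so their product divides \<open>m\<close> and is
  at most \<open>\<bar>m\<bar>\<close>. The bound serves twice: for differences \<open>a - b\<close>
  in the sieve, and for the prime divisors of \<open>n\<close> left out of it.\<close>

lemma sum_ln_prime_divisors_le: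
  fixes m :: int
  assumes "finite P" "\<And>p. p \<in> P \<Longrightarrow> prime p" "\<And>p. p \<in> P \<Longrightarrow> int p dvd m" "m \<noteq> 0"
  shows "(\<Sum>p\<in>P. ln (real p)) \<le> ln \<bar>real_of_int m\<bar>"
proof -
  have "(\<Prod>p\<in>P. int p) dvd m"
    using assms(1-3)
  proof (induction P)
    case (insert p P)
    have "coprime (int p) (\<Prod>q\<in>P. int q)"
    proof (rule prod_coprime_right)
      fix q assume "q \<in> P"
      then show "coprime (int p) (int q)"
        using insert by (metis coprime_int_iff insertI1 insertI2 primes_coprime)
    qed
    then show ?case
      using insert by (simp add: divides_mult)
  qed simp
  then have "(\<Prod>p\<in>P. int p) \<le> \<bar>m\<bar>"
    using \<open>m \<noteq> 0\<close> by (simp add: zdvd_imp_le)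
  then have le: "(\<Prod>p\<in>P. real p) \<le> \<bar>real_of_int m\<bar>"
    by (metis (no_types, lifting) of_int_abs of_int_le_iff of_int_of_nat_eq of_int_prod prod.cong)
  have pos: "\<And>p. p \<in> P \<Longrightarrow> real p > 0"
    using assms(2) prime_gt_0_nat by simp
  have "(\<Sum>p\<in>P. ln (real p)) = ln (\<Prod>p\<in>P. real p)"
    using assms(1) pos by (simp add: ln_prod)
  also have "\<dots> \<le> ln \<bar>real_of_int m\<bar>"
    using le pos by (intro ln_mono) (auto intro: prod_pos)
  finally show ?thesis .
qed

text \<open>Sorted by residue class, the congruent ordered pairs number the sum of the squared class
  sizes. These sizes add up to \<open>card A\<close>, so Cauchy-Schwarz applies.\<close>

lemma card_cong_pairs_ge:
  fixes A :: "int set" and p :: nat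
  assumes "finite A"
  shows "real (card A) ^ 2 / real (card ((\<lambda>a. a mod int p) ` A))
           \<le> (\<Sum>a\<in>A. \<Sum>b\<in>A. of_bool (int p dvd a - b))"
proof -
  define R where "R = (\<lambda>a. a mod int p) ` A"
  define f where "f r = real (card {a \<in> A. a mod int p = r})" for r
  define v where "v = real (card R)"
  have fin: "finite R"
    using assms by (simp add: R_def)
  have regroup: "(\<Sum>a\<in>A. g (a mod int p)) = (\<Sum>r\<in>R. f r * g r)" for g :: "int \<Rightarrow> real"
    using sum.image_gen[OF assms, of "\<lambda>a. g (a mod int p)" "\<lambda>a. a mod int p"]
    by (simp add: R_def f_def)
  have "(\<Sum>b\<in>A. of_bool (int p dvd a - b)) = f (a mod int p)" for a
  proof -
    have "{b \<in> A. int p dvd a - b} = {b \<in> A. b mod int p = a mod int p}"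
      by (metis mod_eq_dvd_iff)
    moreover have "(\<Sum>b\<in>A. of_bool (int p dvd a - b)) = real (card {b \<in> A. int p dvd a - b})"
      using assms by (simp add: of_bool_def sum.If_cases Int_def)
    ultimately show ?thesis
      by (simp add: f_def)
  qed
  then have pairs: "(\<Sum>a\<in>A. \<Sum>b\<in>A. of_bool (int p dvd a - b)) = (\<Sum>r\<in>R. f r * f r)"
    by (simp add: regroup)
  have total: "(\<Sum>r\<in>R. f r) = real (card A)"
    using regroup[of "\<lambda>_. 1"] by simp
  show ?thesis
  proof (cases "v = 0")
    \<comment> \<open>No occupied class: the quotient is 0 by the convention for division by
      zero.\<close>
    case True
    then show ?thesis
      by (simp add: v_def R_def sum_nonneg)
  next
    case False
    define m where "m = real (card A) / v"
    have "(\<Sum>r\<in>R. 2 * m * f r - m\<^sup>2) = 2 * m * real (card A) - v * m\<^sup>2"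
      by (simp add: sum_subtractf sum_distrib_left[symmetric] total v_def)
    also have "\<dots> = real (card A) ^ 2 / v"
      using False by (simp add: m_def power2_eq_square)
    finally have "real (card A) ^ 2 / v = (\<Sum>r\<in>R. 2 * m * f r - m\<^sup>2)" ..
    also have "\<dots> \<le> (\<Sum>r\<in>R. f r * f r)"
      \<comment> \<open>Cauchy--Schwarz, via the tangent of the square function at the mean \<open>m\<close>\<close>
    proof (rule sum_mono)
      fix r
      show "2 * m * f r - m\<^sup>2 \<le> f r * f r"
        using zero_le_square[of "f r - m"] by (simp add: algebra_simps power2_eq_square)
    qed
    finally show ?thesis
      by (simp add: pairs v_def R_def)
  qed
qed

text \<open>Gallagher's argument: pairs \<open>(a, b)\<close> with \<open>p\<close> dividing
  \<open>a - b\<close> are counted with weight \<open>ln p\<close>, in two ways. Grouping by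
  \<open>p\<close> gives the lower bound of \<open>card_cong_pairs_ge\<close>. Grouping by pair
  gives at most \<open>ln N\<close> off the diagonal, since
  \<open>\<bar>a - b\<bar> \<le> N\<close>.\<close>

lemma larger_sieve:
  fixes A :: "int set" and N :: int
  assumes "A \<subseteq> {1..N}" "A \<noteq> {}"
    and "finite P" "\<And>p. p \<in> P \<Longrightarrow> prime p"
  shows "(\<Sum>p\<in>P. ln (real p) * (real (card A) / real (card ((\<lambda>a. a mod int p) ` A)) - 1))
           \<le> real (card A) * ln (real_of_int N)"
proof -
  have fin: "finite A"
    using assms(1) finite_subset by blast
  define Z where "Z = real (card A)"
  have Z: "Z > 0"
    using fin assms(2) by (simp add: Z_def card_gt_0_iff)
  have "N \<ge> 1"
    using assms(1,2) by auto
  then have lnN: "ln (real_of_int N) \<ge> 0"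
    by simp
  have lnp: "ln (real p) \<ge> 0" if "p \<in> P" for p
    using assms(4)[OF that] prime_gt_0_nat[of p] by (simp add: Suc_leI)
  define T where "T = (\<Sum>p\<in>P. ln (real p))"
  have T: "T \<ge> 0"
    unfolding T_def by (intro sum_nonneg lnp)
  \<comment> \<open>On the diagonal every prime divides 0, which costs the full weight
    \<open>T\<close>; elsewhere only the prime divisors of a nonzero difference count.\<close>
  have pair: "(\<Sum>p\<in>P. ln (real p) * of_bool (int p dvd a - b)) \<le> ln (real_of_int N) + (if a = b then T else 0)"
    if "a \<in> A" "b \<in> A" for a b
  proof (cases "a = b")
    case True
    then show ?thesis
      using lnN by (simp add: T_def)
  next
    case False
    have "(\<Sum>p\<in>P. ln (real p) * of_bool (int p dvd a - b)) = (\<Sum>p\<in>{p\<in>P. int p dvd a - b}. ln (real p))"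
      using assms(3) by (simp add: of_bool_def if_distrib sum.If_cases Int_def cong: if_cong)
    also have "\<dots> \<le> ln \<bar>real_of_int (a - b)\<bar>"
      using False assms(3,4) by (intro sum_ln_prime_divisors_le) auto
    also have "\<dots> \<le> ln (real_of_int N)"
    proof (rule ln_mono)
      have "\<bar>a - b\<bar> \<le> N" and "\<bar>a - b\<bar> \<noteq> 0"
        using that[THEN subsetD[OF assms(1)]] False by auto
      then show "\<bar>real_of_int (a - b)\<bar> \<le> real_of_int N" and "\<bar>real_of_int (a - b)\<bar> > 0"
        by linarith+
    qed
    finally show ?thesis
      using False by simp
  qed
  \<comment> \<open>After multiplication by \<open>Z\<close>, the \<open>- 1\<close> in each bracket
    yields \<open>- Z * T\<close>, which cancels the diagonal contribution.\<close>
  have "Z * (\<Sum>p\<in>P. ln (real p) * (Z / real (card ((\<lambda>a. a mod int p) ` A)) - 1))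
      = (\<Sum>p\<in>P. ln (real p) * (Z\<^sup>2 / real (card ((\<lambda>a. a mod int p) ` A)))) - Z * T"
    by (simp add: T_def sum_distrib_left sum_subtractf[symmetric] power2_eq_square algebra_simps)
  also have "(\<Sum>p\<in>P. ln (real p) * (Z\<^sup>2 / real (card ((\<lambda>a. a mod int p) ` A))))
      \<le> (\<Sum>p\<in>P. ln (real p) * (\<Sum>a\<in>A. \<Sum>b\<in>A. of_bool (int p dvd a - b)))"
    unfolding Z_def using lnp fin by (intro sum_mono mult_left_mono card_cong_pairs_ge) auto
  also have "\<dots> = (\<Sum>a\<in>A. \<Sum>b\<in>A. \<Sum>p\<in>P. ln (real p) * of_bool (int p dvd a - b))"
    by (simp add: sum_distrib_left sum.swap[of _ A P])
  also have "\<dots> \<le> (\<Sum>a\<in>A. \<Sum>b\<in>A. ln (real_of_int N) + (if a = b then T else 0))"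
    by (intro sum_mono pair)
  also have "\<dots> = Z * (Z * ln (real_of_int N)) + Z * T"
    using fin by (simp add: sum.distrib Z_def distrib_left)
  finally have "Z * (\<Sum>p\<in>P. ln (real p) * (Z / real (card ((\<lambda>a. a mod int p) ` A)) - 1))
      \<le> Z * (Z * ln (real_of_int N))"
    by simp
  then show ?thesis
    using Z by (simp add: Z_def)
qed

section \<open>Residue classes occupied by a set with property D(n)\<close>

lemma Legendre_cong:
  assumes "[a = b] (mod p)"
  shows "Legendre a p = Legendre b p"
proof -
  have "[a = 0] (mod p) \<longleftrightarrow> [b = 0] (mod p)" and "QuadRes p a \<longleftrightarrow> QuadRes p b"
    unfolding QuadRes_def using assms by (meson cong_sym cong_trans)+
  then show ?thesis
    by (simp add: Legendre_def)
qed

lemma Legendre_values: "Legendre a p \<in> {-1, 0, 1}"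
  by (simp add: Legendre_def)

text \<open>Euler's criterion gives the identity modulo \<open>p\<close>. Both sides lie in {-1, 0,
  1}, so they differ by at most 2 < \<open>p\<close> and must be equal.\<close>

lemma Legendre_mult:
  assumes "prime p" "p > (2::nat)"
  shows "Legendre (a * b) (int p) = Legendre a (int p) * Legendre b (int p)"
proof -
  let ?e = "(p - 1) div 2"
  have "[Legendre (a * b) (int p) = (a * b) ^ ?e] (mod int p)"
    using assms by (rule euler_criterion)
  also have "(a * b) ^ ?e = a ^ ?e * b ^ ?e"
    by (rule power_mult_distrib)
  also have "[a ^ ?e * b ^ ?e = Legendre a (int p) * Legendre b (int p)] (mod int p)"
    by (intro cong_mult euler_criterion[OF assms, THEN cong_sym])
  finally have *: "int p dvd Legendre (a * b) (int p) - Legendre a (int p) * Legendre b (int p)"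
    by (simp add: cong_iff_dvd_diff)
  have "\<bar>Legendre (a * b) (int p) - Legendre a (int p) * Legendre b (int p)\<bar> \<le> 2"
    using Legendre_values[of "a * b" "int p"] Legendre_values[of a "int p"] Legendre_values[of b "int p"]
    by auto
  then show ?thesis
    using * assms(2) zdvd_not_zless[of "\<bar>Legendre (a * b) (int p) - Legendre a (int p) * Legendre b (int p)\<bar>" "int p"]
    by auto
qed

text \<open>An affine map with invertible slope permutes the residues modulo \<open>m\<close>.
  Stating it for any periodic \<open>f\<close> covers single symbols, products of symbols and
  squares of sums.\<close>

lemma sum_residues_affine:
  fixes f :: "int \<Rightarrow> 'a::comm_monoid_add"
  assumes "m > 0" "coprime c m" and per: "\<And>x. f (x mod m) = f x"
  shows "(\<Sum>x\<in>{0..<m}. f (c * x + d)) = (\<Sum>x\<in>{0..<m}. f x)"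
proof -
  let ?g = "\<lambda>x. (c * x + d) mod m"
  have inj: "inj_on ?g {0..<m}"
  proof (rule inj_onI)
    fix x y assume xy: "x \<in> {0..<m}" "y \<in> {0..<m}" "?g x = ?g y"
    then have "[c * x = c * y] (mod m)"
      by (metis cong_add_rcancel cong_def)
    then have "[x = y] (mod m)"
      using assms(2) by (simp add: cong_mult_lcancel)
    then show "x = y"
      using xy by (auto simp: cong_def)
  qed
  have "?g ` {0..<m} \<subseteq> {0..<m}"
    using assms(1) by auto
  then have "?g ` {0..<m} = {0..<m}"
    using inj by (intro endo_inj_surj) auto
  then have "(\<Sum>x\<in>{0..<m}. f x) = (\<Sum>x\<in>{0..<m}. f (?g x))"
    using sum.reindex[OF inj, of f] by simp
  also have "\<dots> = (\<Sum>x\<in>{0..<m}. f (c * x + d))"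
    by (simp only: per)
  finally show ?thesis ..
qed

text \<open>Multiplication by a nonresidue \<open>g\<close> permutes the residues and flips every
  sign, so the sum equals its own negative.\<close>

lemma sum_Legendre_eq_0:
  assumes "prime p" "p > (2::nat)"
  shows "(\<Sum>x\<in>{0..<int p}. Legendre x (int p)) = 0"
proof -
  \<comment> \<open>If every residue were a square, squaring would be onto and hence injective on a
    finite set; but 1 and \<open>p - 1\<close> have the same square and differ because
    \<open>p > 2\<close>.\<close>
  obtain g where g: "g \<in> {0..<int p}" "\<not> QuadRes (int p) g"
  proof (rule ccontr)
    assume "\<not> thesis"
    then have res: "\<And>g. g \<in> {0..<int p} \<Longrightarrow> QuadRes (int p) g"
      using that by blast
    let ?s = "\<lambda>x. x ^ 2 mod int p"
    have "{0..<int p} \<subseteq> ?s ` {0..<int p}"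
    proof
      fix g assume g: "g \<in> {0..<int p}"
      then obtain y where "[y ^ 2 = g] (mod int p)"
        using res by (auto simp: QuadRes_def)
      then have "g = ?s (y mod int p)"
        using g by (simp add: cong_def power_mod)
      then show "g \<in> ?s ` {0..<int p}"
        using assms(2) by (intro image_eqI[of _ _ "y mod int p"]) auto
    qed
    then have "inj_on ?s {0..<int p}"
      by (intro finite_surj_inj) auto
    moreover have "(int p - 1) ^ 2 mod int p = 1 ^ 2 mod int p"
      by (simp add: power2_eq_square algebra_simps mod_eq_dvd_iff)
    ultimately have "int p - 1 = 1"
      using assms(2) by (elim inj_onD) auto
    then show False
      using assms(2) by simp
  qed
  have "\<not> [g = 0] (mod int p)"
  proof
    assume "[g = 0] (mod int p)"
    then have "[0 ^ 2 = g] (mod int p)"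
      by (simp add: cong_sym)
    then show False
      using g(2) unfolding QuadRes_def by blast
  qed
  with g have Lg: "Legendre g (int p) = -1"
    by (simp add: Legendre_def)
  have "coprime g (int p)"
    using \<open>\<not> [g = 0] (mod int p)\<close> assms(1)
    by (metis cong_0_iff coprime_commute prime_imp_coprime prime_nat_int_transfer)
  then have "(\<Sum>x\<in>{0..<int p}. Legendre (g * x + 0) (int p)) = (\<Sum>x\<in>{0..<int p}. Legendre x (int p))"
    using assms by (intro sum_residues_affine) (auto intro: Legendre_cong)
  then show ?thesis
    by (simp add: Legendre_mult[OF assms] Lg sum_negf)
qed

lemma sum_Legendre_sq:
  assumes "prime p"
  shows "(\<Sum>x\<in>{0..<int p}. (Legendre x (int p))\<^sup>2) = int p - 1"
proof -
  have "(Legendre x (int p))\<^sup>2 = 1 - of_bool (x = 0)" if "x \<in> {0..<int p}" for x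
    using that by (auto simp: Legendre_def cong_def)
  then have "(\<Sum>x\<in>{0..<int p}. (Legendre x (int p))\<^sup>2) = (\<Sum>x\<in>{0..<int p}. 1 - of_bool (x = 0))"
    by (rule sum.cong[OF refl])
  also have "\<dots> = int p - 1"
    using prime_gt_0_nat[OF assms] by (simp add: sum_subtractf of_bool_def)
  finally show ?thesis .
qed

text \<open>
  Summing over all pairs \<open>(s, t)\<close>, and not only over \<open>t = 1\<close>, makes the off-diagonal terms
  vanish: \<open>(s, t) \<mapsto> (s y + t n, s z + t n)\<close> is an invertible linear map when
  \<open>y \<noteq> z\<close>. By homogeneity every nonzero \<open>t\<close> contributes as much as \<open>t = 1\<close>.
\<close>

lemma sum_Legendre_pair:
  assumes "prime p" "p > (2::nat)" "\<not> int p dvd n"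
  shows "(\<Sum>t\<in>{0..<int p}. \<Sum>s\<in>{0..<int p}. Legendre (s * y + t * n) (int p) * Legendre (s * z + t * n) (int p))
           = (if [y = z] (mod int p) then int p * (int p - 1) else 0)"
proof -
  let ?I = "{0..<int p}" and ?\<chi> = "\<lambda>x. Legendre x (int p)"
  have p: "int p > 0"
    using assms(2) by simp
  have \<chi>mod: "?\<chi> (x mod int p) = ?\<chi> x" for x
    by (intro Legendre_cong) simp
  have cop: "coprime c (int p)" if "\<not> int p dvd c" for c
    using that assms(1) by (metis coprime_commute prime_imp_coprime prime_nat_int_transfer)
  have "(\<Sum>t\<in>?I. \<Sum>s\<in>?I. ?\<chi> (s * y + t * n) * ?\<chi> (s * z + t * n))
      = (\<Sum>s\<in>?I. \<Sum>t\<in>?I. ?\<chi> (n * t + s * y) * ?\<chi> (n * t + s * y + s * (z - y)))"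
    by (subst sum.swap) (simp add: algebra_simps)
  \<comment> \<open>For fixed \<open>s\<close> the substitution \<open>u = n * t + s * y\<close> is
    a permutation, as \<open>p\<close> does not divide \<open>n\<close>.\<close>
  also have "\<dots> = (\<Sum>s\<in>?I. \<Sum>u\<in>?I. ?\<chi> u * ?\<chi> (u + s * (z - y)))"
  proof (rule sum.cong[OF refl])
    fix s
    have "?\<chi> (x mod int p + s * (z - y)) = ?\<chi> (x + s * (z - y))" for x
      by (intro Legendre_cong) (simp add: cong_def mod_simps)
    then show "(\<Sum>t\<in>?I. ?\<chi> (n * t + s * y) * ?\<chi> (n * t + s * y + s * (z - y)))
        = (\<Sum>u\<in>?I. ?\<chi> u * ?\<chi> (u + s * (z - y)))"
      using p cop[OF assms(3)]
      by (intro sum_residues_affine[where f = "\<lambda>x. ?\<chi> x * ?\<chi> (x + s * (z - y))"]) (simp_all add: \<chi>mod)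
  qed
  \<comment> \<open>The inner sum over \<open>s\<close> is now a complete character sum, which
    vanishes, unless \<open>z - y\<close> is divisible by \<open>p\<close>, when it is constant in
    \<open>s\<close>.\<close>
  also have "\<dots> = (\<Sum>u\<in>?I. ?\<chi> u * (\<Sum>s\<in>?I. ?\<chi> ((z - y) * s + u)))"
    by (subst sum.swap) (simp add: sum_distrib_left algebra_simps)
  also have "\<dots> = (if [y = z] (mod int p) then int p * (int p - 1) else 0)"
  proof (cases "[y = z] (mod int p)")
    case True
    then have "int p dvd z - y"
      by (simp add: cong_iff_dvd_diff dvd_diff_commute)
    then have "?\<chi> ((z - y) * s + u) = ?\<chi> u" for s u
      by (intro Legendre_cong) (simp add: cong_iff_dvd_diff)
    then have "(\<Sum>u\<in>?I. ?\<chi> u * (\<Sum>s\<in>?I. ?\<chi> ((z - y) * s + u))) = int p * (\<Sum>u\<in>?I. (?\<chi> u)\<^sup>2)"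
      by (simp add: sum_distrib_left power2_eq_square algebra_simps)
    then show ?thesis
      using True sum_Legendre_sq[OF assms(1)] by simp
  next
    case False
    then have "\<not> int p dvd z - y"
      by (simp add: cong_iff_dvd_diff dvd_diff_commute)
    then have "(\<Sum>s\<in>?I. ?\<chi> ((z - y) * s + u)) = (\<Sum>x\<in>?I. ?\<chi> x)" for u
      using p by (intro sum_residues_affine cop \<chi>mod)
    then show ?thesis
      using False sum_Legendre_eq_0[OF assms(1,2)] by simp
  qed
  finally show ?thesis .
qed

text \<open>Expanding the squares and summing over all \<open>(s, t)\<close> leaves only the terms
  \<open>y = z\<close>, each equal to \<open>p * (p - 1)\<close>. The factor \<open>p - 1\<close>
  cancels because all rows with \<open>t\<close> nonzero have the same sum.\<close>

lemma sum_Legendre_bilinear_le: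
  assumes "prime p" "p > (2::nat)" "\<not> int p dvd n" "finite B" "inj_on (\<lambda>b. b mod int p) B"
  shows "(\<Sum>x\<in>{0..<int p}. (\<Sum>y\<in>B. Legendre (x * y + n) (int p))\<^sup>2) \<le> int p * int (card B)"
proof -
  let ?I = "{0..<int p}" and ?\<chi> = "\<lambda>x. Legendre x (int p)"
  define T where "T s t = (\<Sum>y\<in>B. ?\<chi> (s * y + t * n))" for s t
  have p: "int p > 0"
    using assms(2) by simp
  have cong_iff: "[y = z] (mod int p) \<longleftrightarrow> y = z" if "y \<in> B" "z \<in> B" for y z
    using that assms(5) by (auto simp: cong_def inj_on_def)
  \<comment> \<open>The substitution \<open>s = t * x\<close> pulls the factor
    \<open>?\<chi> t\<close> out of every symbol, and its square is 1.\<close>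
  have row: "(\<Sum>s\<in>?I. (T s t)\<^sup>2) = (\<Sum>x\<in>?I. (T x 1)\<^sup>2)" if t: "t \<in> {1..<int p}" for t
  proof -
    have cop: "coprime t (int p)"
    proof -
      have "\<not> int p dvd t"
        using t zdvd_not_zless[of t "int p"] by simp
      then show ?thesis
        using assms(1) by (metis coprime_commute prime_imp_coprime prime_nat_int_transfer)
    qed
    then have "\<not> [t = 0] (mod int p)"
      using assms(2) by (auto simp: cong_0_iff coprime_absorb_right)
    then have \<chi>t: "(?\<chi> t)\<^sup>2 = 1"
      by (simp add: Legendre_def)
    have "T (s mod int p) t = T s t" for s
      unfolding T_def by (rule sum.cong[OF refl], rule Legendre_cong) (simp add: cong_add cong_mult)
    then have "(\<Sum>s\<in>?I. (T s t)\<^sup>2) = (\<Sum>x\<in>?I. (T (t * x + 0) t)\<^sup>2)"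
      using p cop by (intro sum_residues_affine[where f = "\<lambda>s. (T s t)\<^sup>2", symmetric]) simp_all
    also have "\<dots> = (\<Sum>x\<in>?I. (?\<chi> t * T x 1)\<^sup>2)"
      by (simp only: T_def sum_distrib_left Legendre_mult[OF assms(1,2), symmetric])
        (simp add: algebra_simps)
    also have "\<dots> = (\<Sum>x\<in>?I. (T x 1)\<^sup>2)"
      by (simp add: power_mult_distrib \<chi>t)
    finally show ?thesis .
  qed
  have "(int p - 1) * (\<Sum>x\<in>?I. (T x 1)\<^sup>2) = (\<Sum>t\<in>{1..<int p}. \<Sum>x\<in>?I. (T x 1)\<^sup>2)"
    using p by simp
  also have "\<dots> = (\<Sum>t\<in>{1..<int p}. \<Sum>s\<in>?I. (T s t)\<^sup>2)"
    by (rule sum.cong[OF refl row[symmetric]])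
  \<comment> \<open>The row \<open>t = 0\<close> is nonnegative; adding it completes the range for
    \<open>sum_Legendre_pair\<close>.\<close>
  also have "\<dots> \<le> (\<Sum>t\<in>?I. \<Sum>s\<in>?I. (T s t)\<^sup>2)"
    by (intro sum_mono2 sum_nonneg) auto
  also have "\<dots> = (\<Sum>y\<in>B. \<Sum>z\<in>B. \<Sum>t\<in>?I. \<Sum>s\<in>?I. ?\<chi> (s * y + t * n) * ?\<chi> (s * z + t * n))"
    unfolding T_def power2_eq_square sum_product
    by (simp only: sum.swap[of _ B ?I])
  also have "\<dots> = (\<Sum>y\<in>B. \<Sum>z\<in>B. if y = z then int p * (int p - 1) else 0)"
    by (intro sum.cong refl) (simp add: sum_Legendre_pair[OF assms(1-3)] cong_iff)
  also have "\<dots> = (int p - 1) * (int p * int (card B))"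
    using assms(4) by (simp add: mult.commute)
  finally show ?thesis
    using assms(2) by (simp add: T_def)
qed

text \<open>For \<open>v\<close> occupied classes, each row sum of symbols over them is at least
  \<open>v - 3\<close>, because almost all entries are 1. The bilinear estimate then gives
  \<open>v * (v - 3)^2 \<le> p * v\<close>.\<close>

lemma card_residues_le:
  fixes A :: "int set"
  assumes "prime p" "p > (2::nat)" "\<not> int p dvd n" "finite A"
    and sq: "\<And>a b. a \<in> A \<Longrightarrow> b \<in> A \<Longrightarrow> a \<noteq> b \<Longrightarrow> is_square (a * b + n)"
  shows "real (card ((\<lambda>a. a mod int p) ` A)) \<le> sqrt (real p) + 3"
proof -
  let ?\<chi> = "\<lambda>x. Legendre x (int p)"
  define R where "R = (\<lambda>a. a mod int p) ` A"
  have R: "finite R" "R \<subseteq> {0..<int p}"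
    using assms(2,4) by (auto simp: R_def)
  have inj: "inj_on (\<lambda>b. b mod int p) R"
    by (auto simp: R_def inj_on_def)
  \<comment> \<open>Distinct residues have distinct representatives in \<open>A\<close>, so
    \<open>x * y + n\<close> is a square modulo \<open>p\<close>: its symbol is 1, or 0 if
    \<open>p\<close> divides it.\<close>
  have off: "?\<chi> (x * y + n) = 1 - of_bool (int p dvd x * y + n)" if xy: "x \<in> R" "y \<in> R" "x \<noteq> y" for x y
  proof -
    obtain a b where ab: "a \<in> A" "b \<in> A" "x = a mod int p" "y = b mod int p"
      using xy by (auto simp: R_def)
    then obtain k where k: "a * b + n = k ^ 2"
      using sq xy(3) by (metis is_nth_power_def)
    have "[k ^ 2 = x * y + n] (mod int p)"
      unfolding k[symmetric] ab(3,4) by (intro cong_add cong_mult cong_refl) (simp_all add: cong_def)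
    then show ?thesis
      by (auto simp: Legendre_def QuadRes_def cong_0_iff)
  qed
  \<comment> \<open>The 3 consists of 1 for the single possible zero in the row and 2 for the
    diagonal entry, where a 1 may turn into -1.\<close>
  have row: "int (card R) - 3 \<le> (\<Sum>y\<in>R. ?\<chi> (x * y + n))" if x: "x \<in> R" for x
  proof -
    \<comment> \<open>The congruence \<open>x * y = - n\<close> has no solution if \<open>p\<close>
      divides \<open>x\<close>, since \<open>p\<close> does not divide \<open>n\<close>, and one
      class of solutions otherwise.\<close>
    have "card {y \<in> R. int p dvd x * y + n} \<le> 1"
    proof (cases "int p dvd x")
      case True
      then have "{y \<in> R. int p dvd x * y + n} = {}"
        using assms(3) by (auto simp: dvd_add_right_iff)
      then show ?thesis
        by (simp only: card.empty)
    next
      case False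
      then have cop: "coprime x (int p)"
        using assms(1) by (metis coprime_commute prime_imp_coprime prime_nat_int_transfer)
      have "y = z" if yz: "y \<in> R" "z \<in> R" "int p dvd x * y + n" "int p dvd x * z + n" for y z
      proof -
        have "int p dvd (x * y + n) - (x * z + n)"
          using yz by (intro dvd_diff)
        then have "[x * y = x * z] (mod int p)"
          by (simp add: cong_iff_dvd_diff)
        then have "[y = z] (mod int p)"
          using cop by (simp add: cong_mult_lcancel)
        then show ?thesis
          using inj yz by (auto simp: cong_def inj_on_def)
      qed
      then show ?thesis
        using R(1) by (subst One_nat_def, subst card_le_Suc0_iff_eq) auto
    qed
    then have zeros: "(\<Sum>y\<in>R. of_bool (int p dvd x * y + n)) \<le> (1::int)"
      using R(1) by (simp add: of_bool_def sum.If_cases Int_def)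
    have "(\<Sum>y\<in>R. 1 - of_bool (int p dvd x * y + n) - 2 * of_bool (y = x)) \<le> (\<Sum>y\<in>R. ?\<chi> (x * y + n))"
    proof (rule sum_mono)
      fix y assume "y \<in> R"
      then show "1 - of_bool (int p dvd x * y + n) - 2 * of_bool (y = x) \<le> ?\<chi> (x * y + n)"
        using off[OF x] Legendre_values[of "x * y + n" "int p"]
        by (cases "y = x") auto
    qed
    moreover have "(\<Sum>y\<in>R. of_bool (y = x)) = (1::int)"
      using R(1) x by (simp add: of_bool_def)
    ultimately show ?thesis
      using zeros by (simp add: sum_subtractf sum_distrib_left[symmetric])
  qed
  show ?thesis
  \<comment> \<open>Squaring the row bound needs \<open>card R - 3\<close> to be nonnegative; small
    \<open>R\<close> satisfy the claim trivially.\<close>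
  proof (cases "card R \<le> 3")
    case True
    then have "real (card R) \<le> 3"
      by simp
    then show ?thesis
      unfolding R_def using real_sqrt_ge_zero[of "real p"] by linarith
  next
    case False
    have "int (card R) * (int (card R) - 3)\<^sup>2 = (\<Sum>x\<in>R. (int (card R) - 3)\<^sup>2)"
      by simp
    also have "\<dots> \<le> (\<Sum>x\<in>R. (\<Sum>y\<in>R. ?\<chi> (x * y + n))\<^sup>2)"
      using False row by (intro sum_mono power_mono) auto
    also have "\<dots> \<le> (\<Sum>x\<in>{0..<int p}. (\<Sum>y\<in>R. ?\<chi> (x * y + n))\<^sup>2)"
      using R by (intro sum_mono2) auto
    also have "\<dots> \<le> int p * int (card R)"
      using assms(1-3) R(1) inj by (rule sum_Legendre_bilinear_le)
    finally have "int (card R) * (int (card R) - 3)\<^sup>2 \<le> int (card R) * int p"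
      by (simp add: mult.commute)
    then have "(int (card R) - 3)\<^sup>2 \<le> int p"
      using False by (simp add: mult_le_cancel_left)
    then have "(real (card R) - 3)\<^sup>2 \<le> real p"
      by (metis (mono_tags, lifting) of_int_diff of_int_le_iff of_int_numeral of_int_of_nat_eq of_int_power)
    then have "real (card R) - 3 \<le> sqrt (real p)"
      by (rule real_le_rsqrt)
    then show ?thesis
      by (simp add: R_def)
  qed
qed

section \<open>A Chebyshev bound\<close>

text \<open>Write each \<open>ln k\<close> as the sum of \<open>mangoldt d\<close> over the divisors
  of \<open>k\<close> and swap the sums. Terms with \<open>d > m\<close> vanish, so a common range
  \<open>{1..N}\<close> can serve for both \<open>m\<close> and \<open>2 * m\<close>.\<close>

lemma ln_fact_eq_sum_mangoldt:
  assumes "m \<le> N"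
  shows "ln (fact m) = (\<Sum>d\<in>{1..N}. mangoldt d * real (m div d))"
proof -
  have "ln (fact m) = (\<Sum>k\<in>{1..m}. ln (real k))"
  proof -
    have "fact m = (\<Prod>k\<in>{1..m}. real k)"
      by (simp add: fact_prod)
    then show ?thesis
      using ln_prod[of "{1..m}" real] by simp
  qed
  also have "\<dots> = (\<Sum>k\<in>{1..m}. \<Sum>d\<in>{d\<in>{1..N}. d dvd k}. mangoldt d)"
  proof (rule sum.cong[OF refl])
    fix k assume k: "k \<in> {1..m}"
    have "d \<in> {1..N}" if "d dvd k" for d
      using that k assms dvd_imp_le[of d k] dvd_pos_nat[of k d] by auto
    then have "{d\<in>{1..N}. d dvd k} = {d. d dvd k}"
      by blast
    then show "ln (real k) = (\<Sum>d\<in>{d\<in>{1..N}. d dvd k}. mangoldt d)"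
      using mangoldt_sum[of k, where 'a = real] k by simp
  qed
  also have "\<dots> = (\<Sum>k\<in>{1..m}. \<Sum>d\<in>{1..N}. mangoldt d * of_bool (d dvd k))"
  proof (rule sum.cong[OF refl])
    fix k
    show "(\<Sum>d\<in>{d\<in>{1..N}. d dvd k}. mangoldt d :: real) = (\<Sum>d\<in>{1..N}. mangoldt d * of_bool (d dvd k))"
      using sum.inter_filter[of "{1..N}" "mangoldt :: nat \<Rightarrow> real" "\<lambda>d. d dvd k"]
      by (simp add: of_bool_def if_distrib cong: if_cong)
  qed
  also have "\<dots> = (\<Sum>d\<in>{1..N}. mangoldt d * (\<Sum>k\<in>{1..m}. of_bool (d dvd k)))"
    by (subst sum.swap) (simp only: sum_distrib_left)
  also have "\<dots> = (\<Sum>d\<in>{1..N}. mangoldt d * real (m div d))"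
  proof (rule sum.cong[OF refl])
    fix d assume d: "d \<in> {1..N}"
    have "{k\<in>{1..m}. d dvd k} = (\<lambda>j. d * j) ` {1..m div d}"
    proof (intro equalityI subsetI)
      fix k assume "k \<in> {k\<in>{1..m}. d dvd k}"
      then obtain j where "k = d * j" "1 \<le> d * j" "d * j \<le> m"
        by auto
      then have "j \<in> {1..m div d}"
        using d by (auto simp: less_eq_div_iff_mult_less_eq mult.commute)
      then show "k \<in> (\<lambda>j. d * j) ` {1..m div d}"
        using \<open>k = d * j\<close> by blast
    qed (use d in \<open>auto simp: less_eq_div_iff_mult_less_eq mult.commute\<close>)
    moreover have "card ((\<lambda>j. d * j) ` {1..m div d}) = m div d"
      using d by (subst card_image) (auto intro: inj_onI)
    ultimately show "mangoldt d * (\<Sum>k\<in>{1..m}. of_bool (d dvd k)) = mangoldt d * real (m div d)"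
      by (simp add: of_bool_def sum.If_cases Int_def)
  qed
  finally show ?thesis .
qed

text \<open>Chebyshev's method: the logarithm of the central binomial coefficient is a
  \<open>mangoldt\<close> sum whose integer coefficients \<open>2 * m div d - 2 * (m div d)\<close>
  are at most 1, while the coefficient itself is at least \<open>4 ^ m / (2 * m)\<close>.\<close>

lemma sum_mangoldt_ge:
  assumes "m > 0"
  shows "2 * real m * ln 2 - ln (2 * real m) \<le> (\<Sum>d\<in>{1..2 * m}. mangoldt d)"
proof -
  have "4 ^ m / (2 * real m) \<le> real ((2 * m) choose m)"
    using assms by (rule central_binomial_lower_bound)
  then have "ln (4 ^ m / (2 * real m)) \<le> ln (real ((2 * m) choose m))"
    using assms by (intro ln_mono) auto
  moreover have "ln (4 ^ m / (2 * real m)) = 2 * real m * ln 2 - ln (2 * real m)"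
  proof -
    have "ln ((4::real) ^ m) = real m * ln (2 ^ 2)"
      by (simp add: ln_realpow)
    also have "\<dots> = 2 * real m * ln 2"
      by (subst ln_realpow) simp_all
    finally show ?thesis
      using assms by (subst ln_div) simp_all
  qed
  moreover have "ln (real ((2 * m) choose m)) = ln (fact (2 * m)) - 2 * ln (fact m)"
  proof -
    have "real ((2 * m) choose m) = fact (2 * m) / (fact m * fact m)"
      by (subst binomial_fact) (simp_all add: mult_2)
    then show ?thesis
      by (simp add: ln_div ln_mult)
  qed
  moreover have "\<dots> = (\<Sum>d\<in>{1..2 * m}. mangoldt d * (real (2 * m div d) - 2 * real (m div d)))"
    by (simp add: ln_fact_eq_sum_mangoldt[of _ "2 * m"] sum_distrib_left sum_subtractf[symmetric] algebra_simps)
  moreover have "\<dots> \<le> (\<Sum>d\<in>{1..2 * m}. mangoldt d)"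
  proof (rule sum_mono)
    fix d assume d: "d \<in> {1..2 * m}"
    have "m < d + d * (m div d)"
      using d by (intro dividend_less_times_div) auto
    then have "2 * m < (2 * (m div d) + 2) * d"
      by (simp add: algebra_simps)
    then have "2 * m div d < 2 * (m div d) + 2"
      using d by (subst div_less_iff_less_mult) auto
    then have "real (2 * m div d) - 2 * real (m div d) \<le> 1"
      by linarith
    then show "mangoldt d * (real (2 * m div d) - 2 * real (m div d)) \<le> mangoldt d"
      using mangoldt_nonneg[of d] by (simp add: mult_left_le)
  qed
  ultimately show ?thesis
    by linarith
qed

text \<open>Group the prime powers up to \<open>t\<close> by their base. All powers of one prime
  together contribute at most \<open>ln t\<close>, and proper powers occur only for primes with
  \<open>p\<^sup>2 \<le> t\<close>, of which there are at most \<open>sqrt t\<close>.\<close>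

lemma sum_mangoldt_le:
  assumes "t > 0"
  shows "(\<Sum>d\<in>{1..t}. mangoldt d) \<le> (\<Sum>p | prime p \<and> p \<le> t. ln (real p)) + sqrt (real t) * ln (real t)"
proof -
  define Q where "Q = {d \<in> {1..t}. primepow d}"
  define P where "P = {p. prime p \<and> p \<le> t}"
  define F where "F p = {d \<in> Q. aprimedivisor d = p}" for p
  have fin: "finite P" "finite Q"
    by (simp_all add: P_def Q_def)
  have decomp: "\<exists>k>0. d = p ^ k" if "d \<in> F p" for d p
  proof -
    have "primepow d" "aprimedivisor d = p"
      using that by (auto simp: F_def Q_def)
    then show ?thesis
      unfolding primepow_def by (metis aprimedivisor_prime_power)
  qed
  have image: "aprimedivisor ` Q \<subseteq> P"
  proof
    fix p assume "p \<in> aprimedivisor ` Q"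
    then obtain d where d: "d \<in> Q" "p = aprimedivisor d"
      by blast
    then have "d > 1"
      using primepow_gt_Suc_0 by (simp add: Q_def)
    then show "p \<in> P"
      using d aprimedivisor_nat[of d] aprimedivisor_le_nat[of d] by (auto simp: P_def Q_def)
  qed
  have card_F: "real (card (F p)) * ln (real p) \<le> ln (real p) + of_bool (p\<^sup>2 \<le> t) * ln (real t)" if p: "p \<in> P" for p
  proof -
    have p1: "p > 1" "p \<le> t"
      using p prime_gt_1_nat by (auto simp: P_def)
    define c where "c = nat \<lfloor>log p t\<rfloor>"
    have "F p \<subseteq> (\<lambda>k. p ^ k) ` {1..c}"
    proof
      fix d assume d: "d \<in> F p"
      then obtain k where k: "k > 0" "d = p ^ k"
        using decomp by blast
      then have "p ^ k \<le> t"
        using d by (simp add: F_def Q_def)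
      then have "real k \<le> log p t"
        using p1 by (simp add: le_log_of_power)
      then have "k \<le> c"
        unfolding c_def by linarith
      then show "d \<in> (\<lambda>k. p ^ k) ` {1..c}"
        using k by auto
    qed
    then have "card (F p) \<le> card ((\<lambda>k. p ^ k) ` {1..c})"
      by (intro card_mono) auto
    also have "\<dots> \<le> c"
      using card_image_le[of "{1..c}" "\<lambda>k. p ^ k"] by simp
    finally have "real (card (F p)) \<le> c"
      by simp
    also have "real c \<le> log p t"
      using p1 by (simp add: c_def)
    finally have "real (card (F p)) * ln (real p) \<le> log p t * ln (real p)"
      using p1 by (intro mult_right_mono) auto
    then have le1: "real (card (F p)) * ln (real p) \<le> ln (real t)"
      using p1 by (simp add: log_def)
    show ?thesis
    proof (cases "p\<^sup>2 \<le> t")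
      case True
      then show ?thesis
        using le1 p1 by (simp add: add_increasing)
    next
      case False
      have "d = p" if d: "d \<in> F p" for d
      proof -
        obtain k where k: "k > 0" "d = p ^ k"
          using decomp[OF d] by blast
        have "k < 2"
        proof (rule ccontr)
          assume "\<not> k < 2"
          then have "p\<^sup>2 \<le> p ^ k"
            using p1 by (intro power_increasing) auto
          then show False
            using False k d by (simp add: F_def Q_def)
        qed
        then show ?thesis
          using k by (simp add: numeral_2_eq_2 less_Suc_eq)
      qed
      then have "F p \<subseteq> {p}"
        by blast
      then have "card (F p) \<le> card {p}"
        by (intro card_mono) auto
      then have "real (card (F p)) \<le> 1"
        by simp
      then show ?thesis
        using False p1 by (simp add: mult_right_le_one_le mult.commute)
    qed
  qed
  have "{p \<in> P. p\<^sup>2 \<le> t} \<subseteq> {1..nat \<lfloor>sqrt t\<rfloor>}"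
  proof
    fix p assume p: "p \<in> {p \<in> P. p\<^sup>2 \<le> t}"
    then have "real p \<le> sqrt (real t)"
      by (intro real_le_rsqrt) (simp flip: of_nat_power)
    then show "p \<in> {1..nat \<lfloor>sqrt t\<rfloor>}"
      using p prime_ge_1_nat[of p] by (simp add: P_def le_nat_floor)
  qed
  then have "card {p \<in> P. p\<^sup>2 \<le> t} \<le> card {1..nat \<lfloor>sqrt t\<rfloor>}"
    by (intro card_mono) auto
  then have "real (card {p \<in> P. p\<^sup>2 \<le> t}) \<le> real (nat \<lfloor>sqrt t\<rfloor>)"
    by (simp only: card_atLeastAtMost of_nat_le_iff diff_Suc_1)
  also have "\<dots> \<le> sqrt (real t)"
    by (intro of_nat_floor) simp
  finally have small: "real (card {p \<in> P. p\<^sup>2 \<le> t}) \<le> sqrt (real t)" .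
  have "(\<Sum>d\<in>{1..t}. mangoldt d :: real) = (\<Sum>d\<in>Q. ln (real (aprimedivisor d)))"
    unfolding Q_def by (subst sum.inter_filter) (auto simp: mangoldt_def intro!: sum.cong)
  also have "\<dots> = (\<Sum>p\<in>P. \<Sum>d\<in>F p. ln (real (aprimedivisor d)))"
    unfolding F_def using sum.group[OF fin(2,1) image, of "\<lambda>d. ln (real (aprimedivisor d))"] by simp
  also have "\<dots> = (\<Sum>p\<in>P. real (card (F p)) * ln (real p))"
    by (intro sum.cong refl) (simp add: F_def)
  also have "\<dots> \<le> (\<Sum>p\<in>P. ln (real p) + of_bool (p\<^sup>2 \<le> t) * ln (real t))"
    by (intro sum_mono card_F)
  also have "\<dots> = (\<Sum>p\<in>P. ln (real p)) + real (card {p \<in> P. p\<^sup>2 \<le> t}) * ln (real t)"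
    using fin by (simp add: sum.distrib sum_distrib_right[symmetric] of_bool_def sum.If_cases Int_def)
  also have "\<dots> \<le> (\<Sum>p\<in>P. ln (real p)) + sqrt (real t) * ln (real t)"
    using small assms by (intro add_left_mono mult_right_mono) auto
  finally show ?thesis
    by (simp add: P_def)
qed

section \<open>Numerical logarithm bounds and the Chebyshev bound from 4 onwards\<close>

text \<open>Since e < 2.72, a lower bound for a logarithm reduces to a comparison of rational
  numbers.\<close>

lemma ln_ge_of_power_le:
  assumes "(272/100) ^ k \<le> x"
  shows "real k \<le> ln x"
proof -
  have "exp (real k) = exp 1 ^ k"
    by (simp flip: exp_of_nat_mult)
  also have "\<dots> \<le> (272/100) ^ k"
    using e_less_272 by (intro power_mono) auto
  finally have "exp (real k) \<le> x"
    using assms by linarith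
  then show ?thesis
    by (meson exp_gt_zero ln_ge_iff less_le_trans)
qed

text \<open>This is the tangent to the logarithm at \<open>2 ^ k\<close>, with \<open>ln 2\<close>
  replaced by the rational upper bound 25/36.\<close>

lemma ln_le_line: "ln x \<le> x / 2 ^ k - 1 + real k * (25/36)" if "x > 0" for x :: real
proof -
  have "ln (x / 2 ^ k) \<le> x / 2 ^ k - 1"
    using that by (intro ln_le_minus_one) simp
  moreover have "ln (x / 2 ^ k) = ln x - real k * ln 2"
    using that by (simp add: ln_div ln_realpow)
  moreover have "real k * ln 2 \<le> real k * (25/36)"
    by (intro mult_left_mono ln2_le_25_over_36) simp
  ultimately show ?thesis
    by linarith
qed

lemma sum_ln_ge_of_power_le_prod:
  fixes X :: "nat set"
  assumes "finite X" "0 \<notin> X" "(272/100) ^ k \<le> real (\<Prod>X)"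
  shows "real k \<le> (\<Sum>x\<in>X. ln (real x))"
proof -
  have "real k \<le> ln (real (\<Prod>X))"
    using assms(3) by (rule ln_ge_of_power_le)
  also have "real (\<Prod>X) = (\<Prod>x\<in>X. real x)"
    by (simp add: of_nat_prod)
  also have "ln \<dots> = (\<Sum>x\<in>X. ln (real x))"
    using assms(1,2) by (intro ln_prod) (auto intro: gr0I)
  finally show ?thesis .
qed

text \<open>One lower bound \<open>k\<close> for the logarithms of finitely many primes settles
  every \<open>t\<close> from the largest of them up to \<open>3 * k + 4\<close>.\<close>

lemma theta_ge_of_sum:
  assumes "X \<subseteq> {p \<in> {5..t}. prime p}" "t \<le> 3 * k + 4" "real k \<le> (\<Sum>x\<in>X. ln (real x))"
  shows "(real t - 4) / 3 \<le> (\<Sum>p\<in>{p \<in> {5..t}. prime p}. ln (real p))"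
proof -
  have "real t \<le> real (3 * k + 4)"
    using assms(2) by (simp only: of_nat_le_iff)
  then have "(real t - 4) / 3 \<le> real k"
    by simp
  also note assms(3)
  also have "(\<Sum>p\<in>X. ln (real p)) \<le> (\<Sum>p\<in>{p \<in> {5..t}. prime p}. ln (real p))"
    using assms(1) by (intro sum_mono2) auto
  finally show ?thesis .
qed

text \<open>Trial division: below 169 = 13^2 a composite number has a prime factor less than
  13.\<close>

lemma prime_of_not_dvd_small:
  fixes p :: nat
  assumes "1 < p" "p < 169" "\<not> 2 dvd p" "\<not> 3 dvd p" "\<not> 5 dvd p" "\<not> 7 dvd p" "\<not> 11 dvd p"
  shows "prime p"
proof -
  have False if q: "prime q" "q dvd p" "q\<^sup>2 \<le> p" for q
  proof -
    have "q\<^sup>2 < 13\<^sup>2"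
      using q(3) assms(2) by simp
    then have "q < 13"
      by (rule power_less_imp_less_base) simp
    then have "q = 2 \<or> q = 3 \<or> q = 4 \<or> q = 5 \<or> q = 6 \<or> q = 7 \<or> q = 8 \<or> q = 9 \<or> q = 10 \<or> q = 11 \<or> q = 12"
      using prime_ge_2_nat[OF q(1)] by arith
    moreover have "\<not> prime (4::nat)" "\<not> prime (6::nat)" "\<not> prime (8::nat)" "\<not> prime (9::nat)"
        "\<not> prime (10::nat)" "\<not> prime (12::nat)"
      by simp_all
    ultimately show False
      using q(1,2) assms(3-7) by auto
  qed
  then show ?thesis
    using assms(1) by (subst prime_prime_factor_sqrt) auto
qed

text \<open>With \<open>ln 2 \<ge> 2/3\<close> the \<open>mangoldt\<close> sum grows with slope at
  least 2/3. From 400 on, half of this slope absorbs the prime powers, the primes 2 and 3, and the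
  rounding of \<open>t\<close> to an even number.\<close>

lemma theta_ge_large:
  assumes "t \<ge> (400::nat)"
  shows "(real t - 4) / 3 \<le> (\<Sum>p\<in>{p \<in> {5..t}. prime p}. ln (real p))"
proof -
  define m where "m = t div 2"
  have m: "m > 0" "2 * m \<le> t" "t \<le> 2 * m + 1"
    using assms by (auto simp: m_def)
  define s where "s = sqrt (real t)"
  have s2: "s * s = real t"
    by (simp add: s_def)
  have s20: "s \<ge> 20"
    unfolding s_def using assms by (intro real_le_rsqrt) simp
  \<comment> \<open>Tangent at 16 = 2^4 for \<open>ln s\<close>, where \<open>s\<close> starts at
    20.\<close>
  have ln_t: "ln (real t) \<le> 2 * (s / 16 + 16 / 9)"
  proof -
    have "ln (real t) = 2 * ln s"
      using s20 by (simp add: s2[symmetric] ln_mult)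
    then show ?thesis
      using ln_le_line[of s 4] s20 by simp
  qed
  have "(real t - 1) * (2/3) - ln (real t) \<le> 2 * real m * ln 2 - ln (2 * real m)"
  proof -
    have "(real t - 1) * (2/3) \<le> 2 * real m * ln 2"
      using m assms ln2_ge_two_thirds by (intro mult_mono) auto
    moreover have "ln (2 * real m) \<le> ln (real t)"
      using m by (intro ln_mono) auto
    ultimately show ?thesis
      by linarith
  qed
  also have "\<dots> \<le> (\<Sum>d\<in>{1..2 * m}. mangoldt d)"
    using m(1) by (rule sum_mangoldt_ge)
  also have "\<dots> \<le> (\<Sum>d\<in>{1..t}. mangoldt d)"
    using m by (intro sum_mono2 mangoldt_nonneg) auto
  also have "\<dots> \<le> (\<Sum>p | prime p \<and> p \<le> t. ln (real p)) + s * ln (real t)"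
    unfolding s_def using assms by (intro sum_mangoldt_le) simp
  also have "(\<Sum>p | prime p \<and> p \<le> t. ln (real p)) = (\<Sum>p\<in>{p \<in> {5..t}. prime p} \<union> {2, 3}. ln (real p))"
  proof (rule sum.cong[OF _ refl])
    have "p = 2 \<or> p = 3 \<or> p \<ge> 5" if "prime p" for p :: nat
    proof (rule ccontr)
      assume "\<not> ?thesis"
      then have "p = 0 \<or> p = 1 \<or> p = 4"
        by linarith
      then show False
        using that by auto
    qed
    then show "{p. prime p \<and> p \<le> t} = {p \<in> {5..t}. prime p} \<union> {2, 3}"
      using assms by auto
  qed
  also have "\<dots> = (\<Sum>p\<in>{p \<in> {5..t}. prime p}. ln (real p)) + (ln 2 + ln 3)"
    by (subst sum.union_disjoint) auto
  finally have main: "(real t - 1) * (2/3) - ln (real t)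
      \<le> (\<Sum>p\<in>{p \<in> {5..t}. prime p}. ln (real p)) + (ln 2 + ln 3) + s * ln (real t)" .
  have "ln 2 + ln 3 \<le> (2::real)"
    using ln2_le_25_over_36 ln_le_line[of 3 1] by simp
  \<comment> \<open>The constants add up exactly: -2/3 + 4/3 - 2 = -4/3.\<close>
  moreover have "s * ln (real t) + ln (real t) \<le> real t / 3 - 4 / 3"
  proof -
    have "s * ln (real t) + ln (real t) = (s + 1) * ln (real t)"
      by (simp add: distrib_right)
    also have "\<dots> \<le> (s + 1) * (2 * (s / 16 + 16 / 9))"
      using s20 ln_t by (intro mult_left_mono) auto
    also have "\<dots> \<le> s * s / 3 - 4 / 3"
    proof -
      \<comment> \<open>Expansion of the quadratic in \<open>s\<close> around 20, the least value of
        \<open>s\<close>; the remainder 29/6 is its value there.\<close>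
      have "s * s / 3 - 4/3 - (s + 1) * (2 * (s / 16 + 16 / 9)) = (s - 20) * (5 / 24 * s + 35 / 72) + 29 / 6"
        by (simp add: field_simps)
      moreover have "0 \<le> (s - 20) * (5 / 24 * s + 35 / 72)"
        using s20 by simp
      ultimately have "0 \<le> s * s / 3 - 4/3 - (s + 1) * (2 * (s / 16 + 16 / 9))"
        by simp
      then show ?thesis
        by (simp only: diff_ge_0_iff_ge)
    qed
    finally show ?thesis
      by (simp only: s2)
  qed
  ultimately show ?thesis
    using main by (simp add: field_simps)
qed

lemma theta_ge:
  assumes "t \<ge> (4::nat)"
  shows "(real t - 4) / 3 \<le> (\<Sum>p\<in>{p \<in> {5..t}. prime p}. ln (real p))"
proof -
  \<comment> \<open>Together the three blocks list all primes from 5 to 157.\<close>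
  define X :: "nat set" where "X = {5, 7, 11, 13, 17, 19, 23, 29, 31, 37, 41, 43, 47, 53, 59, 61}"
  define Y :: "nat set" where "Y = {67, 71, 73, 79, 83, 89, 97, 101, 103, 107, 109}"
  define Z :: "nat set" where "Z = {113, 127, 131, 137, 139, 149, 151, 157}"
  have small: "prime (5::nat)" "prime (7::nat)" "prime (11::nat)"
    by simp_all
  have X: "\<forall>p\<in>X. prime p \<and> 5 \<le> p \<and> p \<le> 61"
    by (simp add: X_def small prime_of_not_dvd_small del: prime_nat_numeral_eq)
  have Y: "\<forall>p\<in>Y. prime p \<and> 67 \<le> p \<and> p \<le> 109"
    by (simp add: Y_def prime_of_not_dvd_small del: prime_nat_numeral_eq)
  have Z: "\<forall>p\<in>Z. prime p \<and> 113 \<le> p \<and> p \<le> 157"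
    by (simp add: Z_def prime_of_not_dvd_small del: prime_nat_numeral_eq)
  have fin: "finite X" "finite Y" "finite Z"
    by (simp_all add: X_def Y_def Z_def)
  have sums: "real 51 \<le> (\<Sum>x\<in>X. ln (real x))" "real 49 \<le> (\<Sum>x\<in>Y. ln (real x))"
      "real 39 \<le> (\<Sum>x\<in>Z. ln (real x))"
    unfolding X_def Y_def Z_def
    by (rule sum_ln_ge_of_power_le_prod; simp add: power_divide)+
  have disj: "X \<inter> Y = {}" "(X \<union> Y) \<inter> Z = {}"
    using X Y Z by fastforce+
  \<comment> \<open>Each intermediate range starts at a prime whose predecessors from 5 on are all
    used and ends no later than \<open>3 * k + 4\<close>; the last explicit one, with
    \<open>k = 132\<close>, ends exactly at 400.\<close>
  consider "t = 4" | "5 \<le> t" "t \<le> 7" | "7 \<le> t" "t \<le> 13" | "13 \<le> t" "t \<le> 28" | "29 \<le> t" "t \<le> 64"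
    | "61 \<le> t" "t \<le> 157" | "157 \<le> t" "t \<le> 400" | "400 \<le> t"
    using assms by linarith
  then show ?thesis
  proof cases
    case 1
    then show ?thesis
      by simp
  next
    case 2
    show ?thesis
    proof (rule theta_ge_of_sum)
      show "{5} \<subseteq> {p \<in> {5..t}. prime p}" and "t \<le> 3 * 1 + 4"
        using 2 by simp_all
      show "real 1 \<le> (\<Sum>x\<in>{5}. ln (real x))"
        by (rule sum_ln_ge_of_power_le_prod) (simp_all add: power_divide)
    qed
  next
    case 3
    show ?thesis
    proof (rule theta_ge_of_sum)
      show "{5, 7} \<subseteq> {p \<in> {5..t}. prime p}" and "t \<le> 3 * 3 + 4"
        using 3 by simp_all
      show "real 3 \<le> (\<Sum>x\<in>{5, 7}. ln (real x))"
        by (rule sum_ln_ge_of_power_le_prod) (simp_all add: power_divide)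
    qed
  next
    case 4
    show ?thesis
    proof (rule theta_ge_of_sum)
      show "{5, 7, 11, 13} \<subseteq> {p \<in> {5..t}. prime p}" and "t \<le> 3 * 8 + 4"
        using 4 by simp_all
      show "real 8 \<le> (\<Sum>x\<in>{5, 7, 11, 13}. ln (real x))"
        by (rule sum_ln_ge_of_power_le_prod) (simp_all add: power_divide)
    qed
  next
    case 5
    show ?thesis
    proof (rule theta_ge_of_sum)
      show "{5, 7, 11, 13, 17, 19, 23, 29} \<subseteq> {p \<in> {5..t}. prime p}" and "t \<le> 3 * 20 + 4"
        using 5 by simp_all
      show "real 20 \<le> (\<Sum>x\<in>{5, 7, 11, 13, 17, 19, 23, 29}. ln (real x))"
        by (rule sum_ln_ge_of_power_le_prod) (simp_all add: power_divide)
    qed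
  next
    case 6
    show ?thesis
    proof (rule theta_ge_of_sum)
      show "X \<subseteq> {p \<in> {5..t}. prime p}" and "t \<le> 3 * 51 + 4"
        using 6 X by auto
    qed (rule sums)
  next
    case 7
    show ?thesis
    proof (rule theta_ge_of_sum)
      show "X \<union> Y \<union> Z \<subseteq> {p \<in> {5..t}. prime p}" and "t \<le> 3 * 132 + 4"
        using 7 X Y Z by auto
      have "(\<Sum>x\<in>X \<union> Y \<union> Z. ln (real x))
          = (\<Sum>x\<in>X. ln (real x)) + (\<Sum>x\<in>Y. ln (real x)) + (\<Sum>x\<in>Z. ln (real x))"
        using fin disj by (simp add: sum.union_disjoint)
      then show "real 132 \<le> (\<Sum>x\<in>X \<union> Y \<union> Z. ln (real x))"
        using sums by simp
    qed
  next
    case 8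
    then show ?thesis
      by (rule theta_ge_large)
  qed
qed

section \<open>Partial summation and the final estimate\<close>

text \<open>Abel summation as an induction on the upper end \<open>t\<close>: lowering the factor
  \<open>h t\<close> to \<open>h (Suc t)\<close> in front of a nonnegative partial sum only
  decreases the product.\<close>

lemma sum_mult_antimono_nonneg:
  fixes u h :: "nat \<Rightarrow> real"
  assumes partial: "\<And>t. m \<le> t \<Longrightarrow> t \<le> N \<Longrightarrow> 0 \<le> (\<Sum>k\<in>{m..t}. u k)"
    and mono: "\<And>k. m \<le> k \<Longrightarrow> k < N \<Longrightarrow> h (Suc k) \<le> h k"
    and nonneg: "\<And>k. m \<le> k \<Longrightarrow> k \<le> N \<Longrightarrow> 0 \<le> h k"
    and "m \<le> N"
  shows "0 \<le> (\<Sum>k\<in>{m..N}. u k * h k)"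
proof -
  have "h t * (\<Sum>k\<in>{m..t}. u k) \<le> (\<Sum>k\<in>{m..t}. u k * h k)" if "m \<le> t" "t \<le> N" for t
    using that
  proof (induction t rule: nat_induct_at_least)
    case base
    then show ?case
      by simp
  next
    case (Suc t)
    have "h (Suc t) * (\<Sum>k\<in>{m..t}. u k) \<le> h t * (\<Sum>k\<in>{m..t}. u k)"
      using Suc partial[of t] mono[of t] by (intro mult_right_mono) auto
    then show ?case
      using Suc by (simp add: algebra_simps)
  qed
  from this[OF \<open>m \<le> N\<close> order_refl] show ?thesis
    using partial[of N] nonneg[of N] \<open>m \<le> N\<close> by (meson mult_nonneg_nonneg order_refl order_trans)
qed

text \<open>The sum of \<open>1 / (sqrt k + 3)\<close> is compared with the integral, whose
  antiderivative is \<open>G\<close>. The range ends at \<open>(K - 3)\<^sup>2\<close>, where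
  \<open>sqrt k + 3\<close> reaches \<open>K\<close> and the weight reaches 0.\<close>

lemma sum_weights_ge:
  fixes K :: real
  assumes "K \<ge> 60"
  defines "N \<equiv> nat \<lfloor>(K - 3)\<^sup>2\<rfloor>"
  shows "K - 6 * ln K \<le> (\<Sum>k\<in>{5..N}. 1 / (sqrt (real k) + 3) - 1 / K)"
proof -
  define G where "G x = 2 * sqrt x - 6 * ln (sqrt x + 3)" for x :: real
  have G': "(G has_real_derivative 1 / (sqrt x + 3)) (at x)" if "x > 0" for x
  proof -
    define s where "s = sqrt x"
    have s: "s > 0" "s + 3 > 0"
      using that by (simp_all add: s_def add_pos_pos)
    have "(G has_real_derivative 2 * (inverse s / 2) - 6 * (inverse s / 2 / (s + 3))) (at x)"
      unfolding G_def s_def using that s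
      by (auto intro!: derivative_eq_intros simp: s_def[symmetric] mult_ac)
    also have "2 * (inverse s / 2) - 6 * (inverse s / 2 / (s + 3)) = 1 / (s + 3)"
      using s by (simp add: divide_simps)
    finally show ?thesis
      by (simp add: s_def)
  qed
  \<comment> \<open>By the mean value theorem the increment is the derivative at some
    \<open>z > k\<close>, and the derivative decreases.\<close>
  have step: "G (real k + 1) - G (real k) \<le> 1 / (sqrt (real k) + 3)" if "k > 0" for k :: nat
  proof -
    obtain z where z: "real k < z" "z < real k + 1"
      "G (real k + 1) - G (real k) = (real k + 1 - real k) * (1 / (sqrt z + 3))"
    proof -
      have "\<exists>z>real k. z < real k + 1 \<and> G (real k + 1) - G (real k) = (real k + 1 - real k) * (1 / (sqrt z + 3))"
      proof (rule MVT2)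
        fix x assume "real k \<le> x"
        then show "(G has_real_derivative 1 / (sqrt x + 3)) (at x)"
          using \<open>k > 0\<close> by (intro G') linarith
      qed simp
      then show ?thesis
        using that by blast
    qed
    have "1 / (sqrt z + 3) \<le> 1 / (sqrt (real k) + 3)"
      using z by (intro divide_left_mono) (auto intro!: add_nonneg_pos mult_pos_pos)
    then show ?thesis
      using z(3) by simp
  qed
  have K3: "(K - 3)\<^sup>2 \<ge> 57\<^sup>2"
    using assms(1) by (intro power_mono) auto
  have N: "real N \<le> (K - 3)\<^sup>2"
    unfolding N_def by (rule of_nat_floor) simp
  have N': "(K - 3)\<^sup>2 \<le> real N + 1"
  proof -
    have "x \<le> real (nat \<lfloor>x\<rfloor>) + 1" for x :: real
      by linarith
    then show ?thesis
      by (simp only: N_def)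
  qed
  have N5: "N \<ge> 5"
    using N' K3 by simp
  have "(\<Sum>k\<in>{5..N}. G (real (Suc k)) - G (real k)) \<le> (\<Sum>k\<in>{5..N}. 1 / (sqrt (real k) + 3))"
    using step by (intro sum_mono) (auto simp: add.commute)
  moreover have "(\<Sum>k\<in>{5..N}. G (real (Suc k)) - G (real k)) = G (real (Suc N)) - G 5"
    using N5 sum_Suc_diff[of 5 N "\<lambda>k. G (real k)"] by simp
  \<comment> \<open>The telescoped sum reaches \<open>Suc N\<close>, beyond
    \<open>(K - 3)\<^sup>2\<close>, so rounding \<open>N\<close> down loses nothing.\<close>
  moreover have "G ((K - 3)\<^sup>2) \<le> G (real (Suc N))"
  proof (rule DERIV_nonneg_imp_nondecreasing[where f = G])
    show "(K - 3)\<^sup>2 \<le> real (Suc N)"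
      using N' by simp
    fix x assume "(K - 3)\<^sup>2 \<le> x" "x \<le> real (Suc N)"
    then have "x > 0"
      using K3 by (intro less_le_trans[of 0 "57\<^sup>2" x]) auto
    then show "\<exists>y. (G has_real_derivative y) (at x) \<and> 0 \<le> y"
      using G'[of x] by (intro exI[of _ "1 / (sqrt x + 3)"]) auto
  qed
  moreover have "G ((K - 3)\<^sup>2) = 2 * (K - 3) - 6 * ln K"
    using assms(1) by (simp add: G_def)
  moreover have "G 5 \<le> -1"
  proof -
    have s5: "sqrt 5 \<le> 5 / 2" "sqrt 5 \<ge> 0"
      by (intro real_le_lsqrt) (auto simp: power2_eq_square)
    have "real 1 \<le> ln (sqrt 5 + 3)"
      using s5(2) by (intro ln_ge_of_power_le) simp
    then show ?thesis
      using s5(1) by (simp add: G_def)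
  qed
  moreover have "(\<Sum>k\<in>{5..N}. 1 / K) \<le> K - 6 + 1"
  proof -
    have "(\<Sum>k\<in>{5..N}. 1 / K) = (real N - 4) / K"
      using N5 by (simp add: of_nat_diff)
    also have "\<dots> \<le> ((K - 3)\<^sup>2 - 4) / K"
      using N assms(1) by (intro divide_right_mono) auto
    also have "\<dots> \<le> K - 6 + 1"
      using assms(1) by (simp add: divide_simps power2_eq_square algebra_simps)
    finally show ?thesis .
  qed
  ultimately show ?thesis
    by (simp add: sum_subtractf)
qed

text \<open>The factor 6.6 is 3 * (2 + 1/5): 2 from the sieve on \<open>[1, n^2]\<close>, 1/5 from
  the primes dividing \<open>n\<close>, and 3 from the Chebyshev slope 1/3.\<close>

lemma card_property_D_less:
  fixes n :: int and K :: real
  defines "L \<equiv> ln (real_of_int \<bar>n\<bar>)"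
  assumes "n \<noteq> 0" "has_property_D n S" "K \<ge> 60" "6.6 * L < K - 6 * ln K"
  shows "real (card (S \<inter> {1..n\<^sup>2})) < K"
proof (rule ccontr)
  define A where "A = S \<inter> {1..n\<^sup>2}"
  define Z where "Z = real (card A)"
  assume "\<not> ?thesis"
  then have ZK: "Z \<ge> K"
    by (simp add: Z_def A_def)
  have finA: "finite A" and A0: "A \<noteq> {}"
    using ZK assms(4) by (auto simp: A_def Z_def)
  have sq: "is_square (a * b + n)" if "a \<in> A" "b \<in> A" "a \<noteq> b" for a b
    using assms(3) that by (simp add: has_property_D_def A_def)
  have L0: "L \<ge> 0"
    using assms(2) unfolding L_def by (intro ln_ge_zero) linarith
  define h where "h x = 1 / (sqrt x + 3) - 1 / K" for x :: real
  define N where "N = nat \<lfloor>(K - 3)\<^sup>2\<rfloor>"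
  define R where "R = {p \<in> {5..N}. prime p}"
  define D where "D = {p \<in> R. int p dvd n}"
  define P where "P = R - D"
  have fin: "finite R" "finite D" "finite P"
    by (simp_all add: R_def D_def P_def)
  have lnp: "ln (real p) \<ge> 0" if "p \<in> R" for p
    using that by (simp add: R_def)
  \<comment> \<open>Here \<open>Z \<ge> K\<close> enters: it gives \<open>1 \<le> Z / K\<close>, so
    the weights \<open>h\<close> no longer depend on \<open>Z\<close>.\<close>
  have "(\<Sum>p\<in>P. ln (real p) * (Z * h p)) \<le> (\<Sum>p\<in>P. ln (real p) * (Z / real (card ((\<lambda>a. a mod int p) ` A)) - 1))"
  proof (intro sum_mono mult_left_mono)
    fix p assume p: "p \<in> P"
    define v where "v = real (card ((\<lambda>a. a mod int p) ` A))"
    have "v > 0"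
      using finA A0 by (simp add: v_def card_gt_0_iff)
    moreover have "v \<le> sqrt (real p) + 3"
      unfolding v_def using p finA sq by (intro card_residues_le[of _ n]) (auto simp: P_def D_def R_def)
    ultimately have "Z / (sqrt (real p) + 3) \<le> Z / v"
      using ZK assms(4) by (intro divide_left_mono) auto
    moreover have "1 \<le> Z / K"
      using ZK assms(4) by simp
    ultimately show "Z * h p \<le> Z / v - 1"
      by (simp add: h_def algebra_simps)
    show "0 \<le> ln (real p)"
      using p lnp by (simp add: P_def)
  qed
  also have "\<dots> \<le> Z * ln (real_of_int (n\<^sup>2))"
    unfolding Z_def using A0 fin(3) by (intro larger_sieve) (auto simp: A_def P_def R_def)
  also have "ln (real_of_int (n\<^sup>2)) = 2 * L"
  proof -
    have "ln (real_of_int (n\<^sup>2)) = ln (real_of_int \<bar>n\<bar> ^ 2)"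
      by simp
    also have "\<dots> = 2 * L"
      unfolding L_def using assms(2) by (subst ln_realpow) auto
    finally show ?thesis .
  qed
  finally have "Z * (\<Sum>p\<in>P. ln (real p) * h p) \<le> Z * (2 * L)"
    by (simp add: sum_distrib_left algebra_simps)
  then have sumP: "(\<Sum>p\<in>P. ln (real p) * h p) \<le> 2 * L"
    using ZK assms(4) by simp
  \<comment> \<open>Primes start at 5, so \<open>sqrt p + 3 \<ge> 5\<close> and
    \<open>h p \<le> 1/5\<close>.\<close>
  have sumD: "(\<Sum>p\<in>D. ln (real p) * h p) \<le> L / 5"
  proof -
    have "(\<Sum>p\<in>D. ln (real p) * h p) \<le> (\<Sum>p\<in>D. ln (real p) * (1 / 5))"
    proof (intro sum_mono mult_left_mono)
      fix p assume p: "p \<in> D"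
      then have "sqrt (real p) \<ge> 2"
        by (intro real_le_rsqrt) (auto simp: D_def R_def)
      then have "1 / (sqrt (real p) + 3) \<le> 1 / 5"
        by (intro divide_left_mono) auto
      then show "h p \<le> 1 / 5"
        using assms(4) by (simp add: h_def algebra_simps add_increasing2)
      show "0 \<le> ln (real p)"
        using p lnp by (simp add: D_def)
    qed
    also have "\<dots> = (\<Sum>p\<in>D. ln (real p)) / 5"
      by (simp add: sum_divide_distrib)
    also have "(\<Sum>p\<in>D. ln (real p)) \<le> L"
      unfolding L_def of_int_abs using fin assms(2)
      by (intro sum_ln_prime_divisors_le) (auto simp: D_def R_def)
    finally show ?thesis
      by simp
  qed
  have K3: "(K - 3)\<^sup>2 \<ge> 57\<^sup>2"
    using assms(4) by (intro power_mono) auto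
  then have "real 5 \<le> (K - 3)\<^sup>2"
    by simp
  then have N5: "N \<ge> 5"
    unfolding N_def by (rule le_nat_floor)
  \<comment> \<open>As \<open>{5..t}\<close> has \<open>t - 4\<close> elements,
    \<open>theta_ge\<close> says exactly that the partial sums of the first factor are
    nonnegative.\<close>
  have "0 \<le> (\<Sum>k\<in>{5..N}. ((if prime k then ln (real k) else 0) - 1 / 3) * h k)"
  proof (rule sum_mult_antimono_nonneg)
    fix t assume t: "5 \<le> t" "t \<le> N"
    have "(\<Sum>k\<in>{5..t}. if prime k then ln (real k) else 0) = (\<Sum>p\<in>{p \<in> {5..t}. prime p}. ln (real p))"
      by (simp only: sum.inter_filter finite_atLeastAtMost)
    then show "0 \<le> (\<Sum>k\<in>{5..t}. (if prime k then ln (real k) else 0) - 1 / 3)"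
      using theta_ge[of t] t by (simp add: sum_subtractf of_nat_diff)
  next
    fix k :: nat
    show "h (Suc k) \<le> h k"
      unfolding h_def by (intro diff_right_mono divide_left_mono) (auto intro!: mult_pos_pos add_nonneg_pos)
    assume "k \<le> N"
    then have "real k \<le> real N"
      by simp
    also have "\<dots> \<le> (K - 3)\<^sup>2"
      unfolding N_def by (rule of_nat_floor) simp
    finally have "real k \<le> (K - 3)\<^sup>2" .
    then have "sqrt (real k) \<le> K - 3"
      using assms(4) by (intro real_le_lsqrt) auto
    then have "1 / K \<le> 1 / (sqrt (real k) + 3)"
      by (intro divide_left_mono) (use assms(4) in \<open>auto intro!: mult_pos_pos add_nonneg_pos\<close>)
    then show "0 \<le> h k"
      by (simp add: h_def)
  qed (use N5 in auto)
  then have "(\<Sum>k\<in>{5..N}. h k) / 3 \<le> (\<Sum>k\<in>{5..N}. (if prime k then ln (real k) else 0) * h k)"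
    by (simp add: left_diff_distrib sum_subtractf sum_divide_distrib)
  also have "\<dots> = (\<Sum>k\<in>{5..N}. if prime k then ln (real k) * h k else 0)"
    by (intro sum.cong) auto
  also have "\<dots> = (\<Sum>p\<in>R. ln (real p) * h p)"
    unfolding R_def by (simp only: sum.inter_filter finite_atLeastAtMost)
  also have "\<dots> = (\<Sum>p\<in>P. ln (real p) * h p) + (\<Sum>p\<in>D. ln (real p) * h p)"
    unfolding P_def using fin by (intro sum.subset_diff) (auto simp: D_def)
  also have "\<dots> \<le> 2.2 * L"
    using sumP sumD by simp
  also have "\<dots> < (K - 6 * ln K) / 3"
    using assms(5) by simp
  also have "\<dots> \<le> (\<Sum>k\<in>{5..N}. h k) / 3"
    using sum_weights_ge[OF assms(4)] unfolding h_def N_def by simp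
  finally show False
    by simp
qed

section \<open>The supremum and the two numerical thresholds\<close>

text \<open>A bounded set of naturals is finite, so a nonempty one contains its supremum; bounding a
  single \<open>S\<close> then suffices.\<close>

lemma C_attained: "\<exists>S. has_property_D n S \<and> C n = card (S \<inter> {1..n\<^sup>2})"
proof -
  let ?V = "(\<lambda>S. card (S \<inter> {1..n\<^sup>2})) ` {S. has_property_D n S}"
  have "?V \<noteq> {}"
    using has_property_D_empty by blast
  moreover have "finite ?V"
    using bdd_above_card_property_D[of n] by (simp only: bdd_above_nat)
  ultimately have "Sup ?V \<in> ?V"
    using cSup_eq_Max[of ?V] Max_in[of ?V] by simp
  then show ?thesis
    by (auto simp: C_def)
qed

theorem proposition1:
  fixes n :: int
  shows "(\<bar>n\<bar> > 400 \<longrightarrow> real (C n) < 11.006 * ln (real_of_int \<bar>n\<bar>)) \<and>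
         (\<bar>n\<bar> \<ge> 10 ^ 100 \<longrightarrow> real (C n) < 8.37 * ln (real_of_int \<bar>n\<bar>))"
proof -
  obtain S where S: "has_property_D n S" "C n = card (S \<inter> {1..n\<^sup>2})"
    using C_attained by blast
  define L where "L = ln (real_of_int \<bar>n\<bar>)"
  \<comment> \<open>Tangent at 64 = 2^6, where the constant is 6 * (-1 + 6 * 25/36) = 19.\<close>
  have ln_bound: "6 * ln x \<le> 6 * (x / 64) + 19" if "x > 0" for x :: real
    using ln_le_line[OF that, of 6] by simp
  have "real (C n) < 11.006 * L" if n: "\<bar>n\<bar> > 400"
  proof -
    \<comment> \<open>The fifth power gives the rational bound \<open>L \<ge> 29/5\<close>, close to
      log 400 = 5.99...\<close>
    have "real 29 \<le> ln (real_of_int \<bar>n\<bar> ^ 5)"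
    proof (rule ln_ge_of_power_le)
      have "(272/100) ^ 29 \<le> (400::real) ^ 5"
        by (simp add: power_divide divide_simps)
      also have "\<dots> \<le> real_of_int \<bar>n\<bar> ^ 5"
        using n by (intro power_mono) auto
      finally show "(272/100) ^ 29 \<le> real_of_int \<bar>n\<bar> ^ 5" .
    qed
    also have "\<dots> = 5 * L"
      unfolding L_def using n by (subst ln_realpow) auto
    finally have L: "L \<ge> 29 / 5"
      by simp
    from L have "6 * ln (11.006 * L) \<le> 6 * (11.006 * L / 64) + 19"
      by (intro ln_bound) simp
    \<comment> \<open>With \<open>K = 11.006 * L\<close> the tangent bound leaves roughly
      \<open>3.37 * L > 19\<close>, which holds from 5.8 on.\<close>
    with L have "6.6 * L < 11.006 * L - 6 * ln (11.006 * L)" "11.006 * L \<ge> 60"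
      by simp_all
    moreover have "n \<noteq> 0"
      using n by simp
    ultimately show ?thesis
      unfolding S(2) L_def by (intro card_property_D_less S(1))
  qed
  moreover have "real (C n) < 8.37 * L" if n: "\<bar>n\<bar> \<ge> 10 ^ 100"
  proof -
    have "real 2 \<le> ln 10"
      by (rule ln_ge_of_power_le) (simp add: power_divide)
    then have "200 \<le> ln ((10::real) ^ 100)"
      by (subst ln_realpow) auto
    also have "\<dots> \<le> L"
    proof -
      have "(10::real) ^ 100 \<le> real_of_int \<bar>n\<bar>"
        using n of_int_le_iff[of "10 ^ 100" "\<bar>n\<bar>", where 'a = real] by (simp only: of_int_power of_int_numeral)
      then show ?thesis
        unfolding L_def by (intro ln_mono zero_less_power) simp_all
    qed
    finally have L: "L \<ge> 200" .
    from L have "6 * ln (8.37 * L) \<le> 6 * (8.37 * L / 64) + 19"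
      by (intro ln_bound) simp
    \<comment> \<open>Now roughly \<open>0.98 * L > 19\<close> is required, and
      \<open>L \<ge> 200\<close> leaves ample room.\<close>
    with L have "6.6 * L < 8.37 * L - 6 * ln (8.37 * L)" "8.37 * L \<ge> 60"
      by simp_all
    moreover have "n \<noteq> 0"
    proof
      assume "n = 0"
      then have "(10::int) ^ 100 \<le> 0"
        using n by (simp only: abs_zero)
      then show False
        by simp
    qed
    ultimately show ?thesis
      unfolding S(2) L_def by (intro card_property_D_less S(1))
  qed
  ultimately show ?thesis
    by (simp add: L_def)
qed

end
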